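(* Let $\mathbb{X}$ and $\mathbb{Y}$ be two complex Banach spaces and let $T \in \mathbb{L}(\mathbb{X},\mathbb{Y})$ be non-zero. Then for any $A \in \mathbb{L}(\mathbb{X},\mathbb{Y})$, $T \perp_B A$ if and only if either (a) or (b) holds: (a) There exists a sequence $\{x_n\}$ in $S_{\mathbb{X}}$ such that $\|Tx_n\| \to \|T\|$ and $\|Ax_n\| \to 0$ as $n \to \infty$. (b) For each $\alpha \in U$, there exist two sequences $\{x_n = x_n(\alpha)\}$, $\{y_n = y_n(\alpha)\}$ in $S_{\mathbb{X}}$ and two sequences of positive real numbers $\{\epsilon_n = \epsilon_n(\alpha)\}$, $\{\delta_n = \delta_n(\alpha)\}$ such that (i) $\epsilon_n \to 0$ and $\delta_n \to 0$ as $n \to \infty$; (ii) $\|Tx_n\| \to \|T\|$ and $\|Ty_n\| \to \|T\|$ as $n \to \infty$; (iii) $Ax_n \in (Tx_n)_\alpha^{+(\epsilon_n)}$ and $Ay_n \in (Ty_n)_\alpha^{-(\delta_n)}$ for all $n \in \mathbb{N}$.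
   Context: $\mathbb{L}(\mathbb{X},\mathbb{Y})$ is the Banach space of all bounded linear operators from $\mathbb{X}$ to $\mathbb{Y}$ with the operator norm, and $S_{\mathbb{X}} = \{x \in \mathbb{X} : \|x\| = 1\}$. For $T, A \in \mathbb{L}(\mathbb{X},\mathbb{Y})$, $T \perp_B A$ (Birkhoff-James orthogonality) means $\|T + \lambda A\| \ge \|T\|$ for all $\lambda \in \mathbb{C}$. $U = \{\alpha \in \mathbb{C} : |\alpha| = 1,\ \arg \alpha \in [0,\pi)\}$. For an element $u$ of a complex Banach space $\mathbb{Z}$, $\alpha \in U$ and $\epsilon \in [0,1)$ define $$u_\alpha^{+(\epsilon)} = \{v \in \mathbb{Z} : \|u + t\alpha v\| \ge \sqrt{1-\epsilon^2}\,\|u\| \text{ for all real } t \ge 0\},$$ $$u_\alpha^{-(\epsilon)} = \{v \in \mathbb{Z} : \|u + t\alpha v\| \ge \sqrt{1-\epsilon^2}\,\|u\| \text{ for all real } t \le 0\}.$$ Use of these notations entails that the parameter $\epsilon$ (in particular each $\epsilon_n$, $\delta_n$) lies in $[0,1)$. *)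

theory Defs
  imports "HOL-Analysis.Analysis"
begin

text \<open>
  HOL-Analysis only has real normed spaces.  A complex normed space is a real one carrying a
  compatible complex scalar multiplication; \<open>1 *\<^sub>C x = x\<close> is the case \<open>r = 1\<close> of
  \<open>scaleC_of_real\<close>.
\<close>

class complex_normed_vector = real_normed_vector +
  fixes scaleC :: "complex \<Rightarrow> 'a \<Rightarrow> 'a"  (infixr \<open>*\<^sub>C\<close> 75)
  assumes scaleC_add_right: "c *\<^sub>C (x + y) = c *\<^sub>C x + c *\<^sub>C y"
    and scaleC_add_left: "(c + d) *\<^sub>C x = c *\<^sub>C x + d *\<^sub>C x"
    and scaleC_scaleC: "c *\<^sub>C d *\<^sub>C x = (c * d) *\<^sub>C x"
    and scaleC_of_real: "complex_of_real r *\<^sub>C x = r *\<^sub>R x"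
    and norm_scaleC: "norm (c *\<^sub>C x) = cmod c * norm x"

class cbanach = complex_normed_vector + banach

instantiation complex :: cbanach
begin

definition scaleC_complex :: "complex \<Rightarrow> complex \<Rightarrow> complex"
  where "scaleC_complex c z = c * z"

instance
  by standard (simp_all add: scaleC_complex_def algebra_simps norm_mult scaleR_conv_of_real)

end

lemma bounded_linear_scaleC: "bounded_linear (\<lambda>x::'a::complex_normed_vector. c *\<^sub>C x)"
proof (rule bounded_linear_intro[where K = "cmod c"])
  fix x y :: 'a and r :: real
  show "c *\<^sub>C (x + y) = c *\<^sub>C x + c *\<^sub>C y"
    by (rule scaleC_add_right)
  show "c *\<^sub>C (r *\<^sub>R x) = r *\<^sub>R (c *\<^sub>C x)"
    by (simp add: scaleC_of_real[symmetric] scaleC_scaleC mult.commute)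
  show "norm (c *\<^sub>C x) \<le> norm x * cmod c"
    by (simp add: norm_scaleC mult.commute)
qed

text \<open>
  Bounded complex-linear operators, as a complex subspace of the library's bounded real-linear
  operators.  Linear structure and operator norm are those of the type \<open>blinfun\<close>.
\<close>

typedef (overloaded) ('a::complex_normed_vector, 'b::complex_normed_vector) cblinfun
    (\<open>(\<open>notation=\<open>infix \<Rightarrow>\<^sub>C\<^sub>L\<close>\<close>_ \<Rightarrow>\<^sub>C\<^sub>L /_)\<close> [22, 21] 21) =
  "{T :: 'a \<Rightarrow>\<^sub>L 'b. \<forall>c x. blinfun_apply T (c *\<^sub>C x) = c *\<^sub>C blinfun_apply T x}"
  morphisms blinfun_of_cblinfun cblinfun_of_blinfun
proof
  show "0 \<in> {T :: 'a \<Rightarrow>\<^sub>L 'b. \<forall>c x. blinfun_apply T (c *\<^sub>C x) = c *\<^sub>C blinfun_apply T x}"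
    using linear_0[OF bounded_linear.linear[OF bounded_linear_scaleC[where 'a='b]]] by simp
qed

setup_lifting type_definition_cblinfun

lift_definition cblinfun_apply ::
    "'a::complex_normed_vector \<Rightarrow>\<^sub>C\<^sub>L 'b::complex_normed_vector \<Rightarrow> 'a \<Rightarrow> 'b"
  is blinfun_apply .

declare [[coercion cblinfun_apply]]

lemma cblinfun_scaleC: "cblinfun_apply T (c *\<^sub>C x) = c *\<^sub>C cblinfun_apply T x"
  by transfer simp

instantiation cblinfun :: (complex_normed_vector, complex_normed_vector) real_normed_vector
begin

lift_definition norm_cblinfun :: "'a \<Rightarrow>\<^sub>C\<^sub>L 'b \<Rightarrow> real" is norm .

lift_definition zero_cblinfun :: "'a \<Rightarrow>\<^sub>C\<^sub>L 'b" is 0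
  using linear_0[OF bounded_linear.linear[OF bounded_linear_scaleC[where 'a='b]]] by simp

lift_definition plus_cblinfun :: "'a \<Rightarrow>\<^sub>C\<^sub>L 'b \<Rightarrow> 'a \<Rightarrow>\<^sub>C\<^sub>L 'b \<Rightarrow> 'a \<Rightarrow>\<^sub>C\<^sub>L 'b" is "(+)"
  by (simp add: blinfun.add_left scaleC_add_right)

lift_definition minus_cblinfun :: "'a \<Rightarrow>\<^sub>C\<^sub>L 'b \<Rightarrow> 'a \<Rightarrow>\<^sub>C\<^sub>L 'b \<Rightarrow> 'a \<Rightarrow>\<^sub>C\<^sub>L 'b" is "(-)"
  by (simp add: blinfun.diff_left linear_diff[OF bounded_linear.linear[OF bounded_linear_scaleC]])

lift_definition uminus_cblinfun :: "'a \<Rightarrow>\<^sub>C\<^sub>L 'b \<Rightarrow> 'a \<Rightarrow>\<^sub>C\<^sub>L 'b" is uminus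
  by (simp add: blinfun.minus_left linear_neg[OF bounded_linear.linear[OF bounded_linear_scaleC]])

lift_definition scaleR_cblinfun :: "real \<Rightarrow> 'a \<Rightarrow>\<^sub>C\<^sub>L 'b \<Rightarrow> 'a \<Rightarrow>\<^sub>C\<^sub>L 'b" is scaleR
  by (simp add: blinfun.scaleR_left linear_scale[OF bounded_linear.linear[OF bounded_linear_scaleC]])

definition dist_cblinfun :: "'a \<Rightarrow>\<^sub>C\<^sub>L 'b \<Rightarrow> 'a \<Rightarrow>\<^sub>C\<^sub>L 'b \<Rightarrow> real"
  where "dist_cblinfun S T = norm (S - T)"

definition [code del]:
  "(uniformity :: (('a \<Rightarrow>\<^sub>C\<^sub>L 'b) \<times> ('a \<Rightarrow>\<^sub>C\<^sub>L 'b)) filter) =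
    (INF e\<in>{0 <..}. principal {(S, T). dist S T < e})"

definition open_cblinfun :: "('a \<Rightarrow>\<^sub>C\<^sub>L 'b) set \<Rightarrow> bool"
  where [code del]: "open_cblinfun U = (\<forall>S\<in>U. \<forall>\<^sub>F (S', T) in uniformity. S' = S \<longrightarrow> T \<in> U)"

definition sgn_cblinfun :: "'a \<Rightarrow>\<^sub>C\<^sub>L 'b \<Rightarrow> 'a \<Rightarrow>\<^sub>C\<^sub>L 'b"
  where "sgn_cblinfun T = inverse (norm T) *\<^sub>R T"

instance
  apply standard
  unfolding dist_cblinfun_def open_cblinfun_def sgn_cblinfun_def uniformity_cblinfun_def
  apply (rule refl | (transfer, force simp: algebra_simps norm_triangle_ineq))+
  done

end

instantiation cblinfun :: (complex_normed_vector, complex_normed_vector) complex_normed_vector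
begin

lift_definition scaleC_cblinfun :: "complex \<Rightarrow> 'a \<Rightarrow>\<^sub>C\<^sub>L 'b \<Rightarrow> 'a \<Rightarrow>\<^sub>C\<^sub>L 'b"
  is "\<lambda>c T. Blinfun (\<lambda>x. c *\<^sub>C blinfun_apply T x)"
  by (subst (1 2) bounded_linear_Blinfun_apply)
     (auto intro!: bounded_linear_compose[OF bounded_linear_scaleC] blinfun.bounded_linear_right
           simp: scaleC_scaleC mult.commute)

lemma cblinfun_apply_scaleC: "cblinfun_apply (c *\<^sub>C T) x = c *\<^sub>C cblinfun_apply T x"
  by transfer
     (simp add: bounded_linear_Blinfun_apply
        bounded_linear_compose[OF bounded_linear_scaleC] blinfun.bounded_linear_right)

lemma cblinfun_apply_add: "cblinfun_apply (S + T) x = cblinfun_apply S x + cblinfun_apply T x"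
  by transfer (rule blinfun.add_left)

lemma cblinfun_apply_scaleR: "cblinfun_apply (r *\<^sub>R T) x = r *\<^sub>R cblinfun_apply T x"
  by transfer (rule blinfun.scaleR_left)

lemma cblinfun_eqI: "(\<And>x. cblinfun_apply S x = cblinfun_apply T x) \<Longrightarrow> S = T"
  by transfer (rule blinfun_eqI)

lemma norm_cblinfun_eq_onorm: "norm T = onorm (cblinfun_apply T)"
  by transfer (simp add: norm_blinfun.rep_eq)

instance
proof
  fix c d :: complex and r :: real and S T :: "'a \<Rightarrow>\<^sub>C\<^sub>L 'b"
  note app = cblinfun_apply_scaleC cblinfun_apply_add cblinfun_apply_scaleR
  show "c *\<^sub>C (S + T) = c *\<^sub>C S + c *\<^sub>C T"
    by (rule cblinfun_eqI) (simp add: app scaleC_add_right)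
  show "(c + d) *\<^sub>C T = c *\<^sub>C T + d *\<^sub>C T"
    by (rule cblinfun_eqI) (simp add: app scaleC_add_left)
  show "c *\<^sub>C d *\<^sub>C T = (c * d) *\<^sub>C T"
    by (rule cblinfun_eqI) (simp add: app scaleC_scaleC)
  show "complex_of_real r *\<^sub>C T = r *\<^sub>R T"
    by (rule cblinfun_eqI) (simp add: app scaleC_of_real)
  have "onorm (\<lambda>x. c *\<^sub>C cblinfun_apply T x) = onorm (\<lambda>x. cmod c *\<^sub>R cblinfun_apply T x)"
    by (simp add: onorm_def norm_scaleC)
  also have "\<dots> = cmod c * onorm (cblinfun_apply T)"
    by (subst onorm_scaleR)
       (simp_all add: cblinfun_apply.rep_eq blinfun.bounded_linear_right)
  finally show "norm (c *\<^sub>C T) = cmod c * norm T"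
    by (simp add: norm_cblinfun_eq_onorm cblinfun_apply_scaleC[abs_def])
qed

end

instance cblinfun :: (complex_normed_vector, cbanach) cbanach
proof
  fix X :: "nat \<Rightarrow> 'a \<Rightarrow>\<^sub>C\<^sub>L 'b"
  assume X: "Cauchy X"
  define Y where "Y n = blinfun_of_cblinfun (X n)" for n
  have dist: "dist (Y m) (blinfun_of_cblinfun S) = dist (X m) S" for m S
    unfolding Y_def dist_norm by (simp add: norm_cblinfun.rep_eq minus_cblinfun.rep_eq)
  have "Cauchy Y"
    using X unfolding Cauchy_def by (metis dist Y_def)
  then obtain L where L: "Y \<longlonglongrightarrow> L"
    by (auto simp: Cauchy_convergent_iff convergent_def)
  have "blinfun_apply L (c *\<^sub>C x) = c *\<^sub>C blinfun_apply L x" for c x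
  proof (rule LIMSEQ_unique)
    show "(\<lambda>n. blinfun_apply (Y n) (c *\<^sub>C x)) \<longlonglongrightarrow> blinfun_apply L (c *\<^sub>C x)"
      by (intro blinfun.tendsto L tendsto_const)
    have "(\<lambda>n. c *\<^sub>C blinfun_apply (Y n) x) \<longlonglongrightarrow> c *\<^sub>C blinfun_apply L x"
      by (intro bounded_linear.tendsto[OF bounded_linear_scaleC] blinfun.tendsto L tendsto_const)
    then show "(\<lambda>n. blinfun_apply (Y n) (c *\<^sub>C x)) \<longlonglongrightarrow> c *\<^sub>C blinfun_apply L x"
      by (simp add: Y_def cblinfun_apply.rep_eq[symmetric] cblinfun_scaleC)
  qed
  then have S: "L = blinfun_of_cblinfun (cblinfun_of_blinfun L)" (is "L = blinfun_of_cblinfun ?S")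
    by (subst cblinfun_of_blinfun_inverse) auto
  have "X \<longlonglongrightarrow> ?S"
    using L dist[of _ ?S] unfolding lim_sequentially S[symmetric] by simp
  then show "convergent X"
    by (auto simp: convergent_def)
qed

definition BJ_orthogonal :: "'a::complex_normed_vector \<Rightarrow> 'a \<Rightarrow> bool"  (infix \<open>\<bottom>\<^sub>B\<close> 50)
  where "u \<bottom>\<^sub>B v \<longleftrightarrow> (\<forall>c::complex. norm (u + c *\<^sub>C v) \<ge> norm u)"

text \<open>
  \<open>Arg\<close> takes values in \<open>(-\<pi>, \<pi>]\<close>; for values in \<open>[0, \<pi>)\<close> this agrees with an argument
  normalised to \<open>[0, 2\<pi>)\<close>.
\<close>

definition unit_half_circle :: "complex set"
  where "unit_half_circle = {\<alpha>. cmod \<alpha> = 1 \<and> 0 \<le> Arg \<alpha> \<and> Arg \<alpha> < pi}"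

text \<open>
  The sets \<open>u\<^sub>\<alpha>\<^sup>+\<^sup>(\<^sup>\<epsilon>\<^sup>)\<close> and \<open>u\<^sub>\<alpha>\<^sup>-\<^sup>(\<^sup>\<epsilon>\<^sup>)\<close>.  The parameter ranges \<open>\<alpha> \<in> unit_half_circle\<close> and
  \<open>0 \<le> \<epsilon> < 1\<close> are not built in; statements using these sets impose them explicitly.
\<close>

definition plus_set :: "complex \<Rightarrow> real \<Rightarrow> 'a::complex_normed_vector \<Rightarrow> 'a set"
  where "plus_set \<alpha> \<epsilon> u =
    {v. \<forall>t::real. t \<ge> 0 \<longrightarrow> norm (u + (of_real t * \<alpha>) *\<^sub>C v) \<ge> sqrt (1 - \<epsilon>\<^sup>2) * norm u}"

definition minus_set :: "complex \<Rightarrow> real \<Rightarrow> 'a::complex_normed_vector \<Rightarrow> 'a set"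
  where "minus_set \<alpha> \<epsilon> u =
    {v. \<forall>t::real. t \<le> 0 \<longrightarrow> norm (u + (of_real t * \<alpha>) *\<^sub>C v) \<ge> sqrt (1 - \<epsilon>\<^sup>2) * norm u}"

end

theory Submission
  imports Defs
begin

text \<open>
  Orthogonality \<open>T \<bottom>\<^sub>B A\<close> says that \<open>norm (T + t *\<^sub>R (\<alpha> *\<^sub>C A)) \<ge> norm T\<close> for
  every unit \<open>\<alpha>\<close> and every \<open>t \<ge> 0\<close>, and the sequences in (a) and (b) are witnesses of these
  inequalities along unit vectors. From sequences to orthogonality one evaluates at the \<open>n\<close>-th
  vector and passes to the limit; in case (b) the half circle suffices because the points
  \<open>t * \<alpha>\<close> with \<open>t\<close> real and \<open>\<alpha>\<close> in it fill the plane.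

  In the other direction suppose that (a) fails, so that \<open>norm (A x) \<ge> c > 0\<close> at every unit \<open>x\<close> where
  \<open>norm (T x)\<close> is close to \<open>norm T\<close> (\<open>not_vanishing_gap\<close>). Take a small step \<open>s\<close> and a unit vector \<open>x\<close>
  at which \<open>T + s *\<^sub>R (\<alpha> *\<^sub>C A)\<close> attains its norm up to \<open>s\<^sup>2\<close>. Orthogonality gives
  \<open>norm (T x + s *\<^sub>R w) \<ge> norm T - s\<^sup>2 \<ge> norm (T x) - s\<^sup>2\<close> with \<open>w = \<alpha> *\<^sub>C A x\<close>. The function
  \<open>g t = norm (T x + t *\<^sub>R w)\<close> is convex, and over the step \<open>s\<close> it falls by at most \<open>s\<^sup>2\<close>; hence its
  secant slope there is at least \<open>-s\<close>, and \<open>g t \<ge> g 0 - s * t\<close> for \<open>t \<ge> s\<close>. Since \<open>norm w \<ge> c\<close>,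
  the function is back above \<open>g 0\<close> once \<open>t \<ge> 2 * norm T / c\<close>, so only a bounded range of \<open>t\<close>
  matters and the loss is \<open>O(s)\<close> uniformly in \<open>t\<close> (\<open>norm_ray_lower_bound\<close>). That is
  membership in the \<open>\<epsilon>\<close>-set with \<open>\<epsilon>\<close> of order \<open>sqrt s\<close> (\<open>exists_unit_in_plus_set\<close>). The
  argument works for every unit \<open>\<alpha>\<close>, and the minus sets of \<open>\<alpha>\<close> are the plus sets of \<open>- \<alpha>\<close>.
\<close>

section \<open>Operator norms\<close>

lemma norm_cblinfun_apply_le: "norm (cblinfun_apply S x) \<le> norm S * norm x"
  by transfer (rule norm_blinfun)

lemma norm_cblinfun_apply_le_unit: "norm x = 1 \<Longrightarrow> norm (cblinfun_apply S x) \<le> norm S"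
  using norm_cblinfun_apply_le[of S x] by simp

lemma cblinfun_unit_vector_exists:
  fixes T :: "'a::complex_normed_vector \<Rightarrow>\<^sub>C\<^sub>L 'b::complex_normed_vector"
  assumes "T \<noteq> 0"
  obtains x :: 'a where "norm x = 1"
proof -
  obtain x where "cblinfun_apply T x \<noteq> 0"
    using assms cblinfun_eqI[of T 0] by (auto simp: cblinfun_apply.rep_eq zero_cblinfun.rep_eq)
  then have "x \<noteq> 0"
    using norm_cblinfun_apply_le[of T x] by auto
  then show ?thesis
    using that[of "sgn x"] by (simp add: norm_sgn)
qed

lemma cblinfun_norm_almost_attained:
  fixes S :: "'a::complex_normed_vector \<Rightarrow>\<^sub>C\<^sub>L 'b::complex_normed_vector"
  assumes unit: "norm (e::'a) = 1" and "\<delta> > 0"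
  obtains x where "norm x = 1" "norm (cblinfun_apply S x) > norm S - \<delta>"
proof -
  have "\<exists>x. norm x = 1 \<and> norm (cblinfun_apply S x) > norm S - \<delta>"
  proof (rule ccontr)
    assume "\<not> ?thesis"
    then have bound: "norm (cblinfun_apply S x) \<le> norm S - \<delta>" if "norm x = 1" for x
      using that by force
    have "norm (cblinfun_apply S x) \<le> (norm S - \<delta>) * norm x" for x
    proof (cases "x = 0")
      case True
      then show ?thesis
        using norm_cblinfun_apply_le[of S x] by simp
    next
      case False
      have "cblinfun_apply S (sgn x) = inverse (norm x) *\<^sub>R cblinfun_apply S x"
        by (simp add: sgn_div_norm scaleC_of_real[symmetric] cblinfun_scaleC)
      then show ?thesis
        using bound[of "sgn x"] False by (simp add: norm_sgn field_simps)
    qed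
    moreover have "0 \<le> norm S - \<delta>"
      using bound[OF unit] norm_ge_zero order_trans by blast
    ultimately have "norm S \<le> norm S - \<delta>"
      unfolding norm_cblinfun_eq_onorm by (intro onorm_bound) auto
    with \<open>\<delta> > 0\<close> show False by simp
  qed
  then show ?thesis
    using that by blast
qed

section \<open>Norms along a ray\<close>

text \<open>
  A convex function that falls by at most \<open>s * h\<close> over a first step \<open>s\<close> never falls faster than at
  rate \<open>h\<close> afterwards. As \<open>norm w \<ge> c\<close> forces growth beyond \<open>t = 2 * m / c\<close>, the total fall
  along the ray is bounded by a constant that is uniform in \<open>t\<close>.
\<close>

lemma norm_ray_lower_bound:
  fixes u w :: "'a::real_normed_vector"
  assumes "0 < s" "0 \<le> h" "0 < c" "c \<le> norm w" "norm u \<le> m"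
    and step: "norm (u + s *\<^sub>R w) \<ge> norm u - s * h"
    and "0 \<le> t"
  shows "norm (u + t *\<^sub>R w) \<ge> norm u - (s * norm w + 2 * m / c * h)"
proof -
  have m: "0 \<le> m"
    using assms(5) norm_ge_zero order_trans by blast
  consider "t \<le> s" | "s < t" "t \<le> 2 * m / c" | "2 * m / c < t"
    by linarith
  then show ?thesis
  proof cases
    case 1
    have "norm u \<le> norm (u + t *\<^sub>R w) + t * norm w"
      using norm_triangle_ineq4[of "u + t *\<^sub>R w" "t *\<^sub>R w"] \<open>0 \<le> t\<close> by simp
    moreover have "t * norm w \<le> s * norm w"
      using 1 by (simp add: mult_right_mono)
    moreover have "0 \<le> 2 * m / c * h"
      using m assms by simp
    ultimately show ?thesis by linarith
  next
    case 2
    \<comment> \<open>The point \<open>u + s *\<^sub>R w\<close> is the convex combination of \<open>u\<close> and \<open>u + t *\<^sub>R w\<close> with weight \<open>s / t\<close>;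
      the convexity inequality is multiplied by \<open>t\<close>.\<close>
    have "t *\<^sub>R (u + s *\<^sub>R w) = (t - s) *\<^sub>R u + s *\<^sub>R (u + t *\<^sub>R w)"
      by (simp add: algebra_simps)
    then have "norm (t *\<^sub>R (u + s *\<^sub>R w)) \<le> norm ((t - s) *\<^sub>R u) + norm (s *\<^sub>R (u + t *\<^sub>R w))"
      by (metis norm_triangle_ineq)
    then have "t * norm (u + s *\<^sub>R w) \<le> (t - s) * norm u + s * norm (u + t *\<^sub>R w)"
      using 2 \<open>0 < s\<close> by simp
    moreover have "t * (norm u - s * h) \<le> t * norm (u + s *\<^sub>R w)"
      using step \<open>0 \<le> t\<close> by (rule mult_left_mono)
    ultimately have "s * (norm u - t * h) \<le> s * norm (u + t *\<^sub>R w)"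
      by (simp add: algebra_simps)
    then have "norm u - t * h \<le> norm (u + t *\<^sub>R w)"
      using \<open>0 < s\<close> by simp
    moreover have "t * h \<le> 2 * m / c * h"
      using 2 \<open>0 \<le> h\<close> by (intro mult_right_mono) auto
    moreover have "0 \<le> s * norm w"
      using \<open>0 < s\<close> by simp
    ultimately show ?thesis by linarith
  next
    case 3
    have "2 * m \<le> t * c"
      using 3 \<open>0 < c\<close> by (simp add: field_simps)
    also have "\<dots> \<le> t * norm w"
      using assms by (intro mult_left_mono) auto
    also have "\<dots> \<le> norm (u + t *\<^sub>R w) + norm u"
      using norm_triangle_ineq4[of "u + t *\<^sub>R w" u] \<open>0 \<le> t\<close> by simp
    finally have "norm u \<le> norm (u + t *\<^sub>R w)"
      using \<open>norm u \<le> m\<close> by linarith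
    moreover have "0 \<le> s * norm w + 2 * m / c * h"
      using m assms by (intro add_nonneg_nonneg mult_nonneg_nonneg) auto
    ultimately show ?thesis by linarith
  qed
qed

lemma minus_set_eq_plus_set: "minus_set \<alpha> \<epsilon> u = plus_set (- \<alpha>) \<epsilon> u"
proof -
  have "(\<forall>t\<le>0. P t) \<longleftrightarrow> (\<forall>t\<ge>0. P (- t))" for P :: "real \<Rightarrow> bool"
    by (metis minus_minus neg_0_le_iff_le)
  from this[of "\<lambda>t. norm (u + (of_real t * \<alpha>) *\<^sub>C v) \<ge> sqrt (1 - \<epsilon>\<^sup>2) * norm u" for v]
  show ?thesis
    by (simp add: minus_set_def plus_set_def)
qed

lemma scaleC_real_mult: "(of_real t * \<alpha>) *\<^sub>C v = t *\<^sub>R (\<alpha> *\<^sub>C v)"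
  by (simp add: scaleC_scaleC[symmetric] scaleC_of_real)

section \<open>From orthogonality to sequences\<close>

lemma norm_apply_tendsto_norm:
  fixes T :: "'a::complex_normed_vector \<Rightarrow>\<^sub>C\<^sub>L 'b::complex_normed_vector"
  assumes "\<And>n. norm (x n) = 1" "\<And>n. norm (T (x n)) > norm T - inverse (real (Suc n))"
  shows "(\<lambda>n. norm (T (x n))) \<longlonglongrightarrow> norm T"
proof -
  have lower: "(\<lambda>n. norm T - inverse (real (Suc n))) \<longlonglongrightarrow> norm T"
    using tendsto_diff[OF tendsto_const LIMSEQ_inverse_real_of_nat] by simp
  show ?thesis
    using assms
    by (intro tendsto_sandwich[OF always_eventually always_eventually lower tendsto_const] allI)
      (auto intro: less_imp_le norm_cblinfun_apply_le_unit)
qed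

lemma not_vanishing_gap:
  fixes T A :: "'a::complex_normed_vector \<Rightarrow>\<^sub>C\<^sub>L 'b::complex_normed_vector"
  assumes "\<nexists>x :: nat \<Rightarrow> 'a. (\<forall>n. norm (x n) = 1) \<and>
      (\<lambda>n. norm (T (x n))) \<longlonglongrightarrow> norm T \<and> (\<lambda>n. norm (A (x n))) \<longlonglongrightarrow> 0"
  obtains c where "c > 0" "\<And>x. norm x = 1 \<Longrightarrow> norm (T x) > norm T - c \<Longrightarrow> norm (A x) \<ge> c"
proof -
  have "\<exists>c>0. \<forall>x. norm x = 1 \<longrightarrow> norm (T x) > norm T - c \<longrightarrow> norm (A x) \<ge> c"
  proof (rule ccontr)
    assume "\<not> ?thesis"
    then have "\<exists>x. norm x = 1 \<and> norm (T x) > norm T - c \<and> norm (A x) < c" if "c > 0" for c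
      using that by (meson not_le)
    then have "\<exists>x. norm x = 1 \<and> norm (T x) > norm T - inverse (real (Suc n)) \<and>
        norm (A x) < inverse (real (Suc n))" for n
      by simp
    then obtain x where x: "\<And>n. norm (x n) = 1"
        "\<And>n. norm (T (x n)) > norm T - inverse (real (Suc n))"
        "\<And>n. norm (A (x n)) < inverse (real (Suc n))"
      by metis
    have "(\<lambda>n. norm (T (x n))) \<longlonglongrightarrow> norm T"
      using norm_apply_tendsto_norm x by blast
    moreover have "(\<lambda>n. norm (A (x n))) \<longlonglongrightarrow> 0"
      using x by (intro tendsto_sandwich[OF always_eventually always_eventually tendsto_const
          LIMSEQ_inverse_real_of_nat] allI) (auto intro: less_imp_le)
    ultimately show False
      using assms x(1) by blast
  qed
  then show ?thesis
    using that by blast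
qed

text \<open>
  The step \<open>s\<close> governs every error: \<open>norm (T x)\<close> misses \<open>norm T\<close> by less than \<open>s\<^sup>2 + s * norm A\<close>, and the
  fall along the ray is at most \<open>s * M\<close> with \<open>M\<close> independent of \<open>x\<close>.
\<close>

lemma exists_unit_in_plus_set:
  fixes T A :: "'a::complex_normed_vector \<Rightarrow>\<^sub>C\<^sub>L 'b::complex_normed_vector"
  assumes "T \<noteq> 0" and orth: "T \<bottom>\<^sub>B A" and \<alpha>: "cmod \<alpha> = 1"
    and c: "c > 0" "\<And>x. norm x = 1 \<Longrightarrow> norm (T x) > norm T - c \<Longrightarrow> norm (A x) \<ge> c"
    and "\<eta> > 0"
  shows "\<exists>x \<epsilon>. norm x = 1 \<and> 0 < \<epsilon> \<and> \<epsilon> < 1 \<and> \<epsilon> < \<eta> \<and> norm (T x) > norm T - \<eta> \<and>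
    A x \<in> plus_set \<alpha> \<epsilon> (T x)"
proof -
  define M where "M = norm A + 2 * norm T / c"
  define k where "k = norm T"
  define \<epsilon> where "\<epsilon> s = sqrt (4 * s * M / k)" for s
  have k: "k > 0"
    using \<open>T \<noteq> 0\<close> by (simp add: k_def)
  have M: "M > 0"
    using k c(1) by (simp add: M_def k_def add_nonneg_pos)
  have "((\<lambda>s. s\<^sup>2 + s * norm A) \<longlongrightarrow> 0\<^sup>2 + 0 * norm A) (at_right 0)"
    by (intro tendsto_intros)
  moreover have "0\<^sup>2 + 0 * norm A < Min {\<eta>, c, k / 2}"
    using \<open>\<eta> > 0\<close> c(1) k by simp
  ultimately have ev1: "\<forall>\<^sub>F s in at_right 0. s\<^sup>2 + s * norm A < Min {\<eta>, c, k / 2}"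
    by (rule order_tendstoD)
  have "(\<epsilon> \<longlongrightarrow> sqrt (4 * 0 * M / k)) (at_right 0)"
    unfolding \<epsilon>_def using k by (intro tendsto_intros) auto
  moreover have "sqrt (4 * 0 * M / k) < min \<eta> 1"
    using \<open>\<eta> > 0\<close> by simp
  ultimately have ev2: "\<forall>\<^sub>F s in at_right 0. \<epsilon> s < min \<eta> 1"
    by (rule order_tendstoD)
  obtain s where s: "s > 0" "s\<^sup>2 + s * norm A < \<eta>" "s\<^sup>2 + s * norm A < c"
      "s\<^sup>2 + s * norm A < k / 2" "\<epsilon> s < \<eta>" "\<epsilon> s < 1"
    using eventually_happens[OF eventually_conj[OF eventually_conj[OF ev1 ev2]
        eventually_at_right_less]]
    by auto
  obtain e :: 'a where "norm e = 1"
    using cblinfun_unit_vector_exists[OF \<open>T \<noteq> 0\<close>] by blast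
  then obtain x where x: "norm x = 1"
      "norm ((T + (of_real s * \<alpha>) *\<^sub>C A) x) > norm (T + (of_real s * \<alpha>) *\<^sub>C A) - s\<^sup>2"
    by (rule cblinfun_norm_almost_attained[where \<delta> = "s\<^sup>2"]) (use s in auto)
  define w where "w = \<alpha> *\<^sub>C A x"
  have w: "norm w = norm (A x)"
    by (simp add: w_def norm_scaleC \<alpha>)
  have "norm (T + (of_real s * \<alpha>) *\<^sub>C A) \<ge> k"
    using orth by (simp add: BJ_orthogonal_def k_def)
  then have step: "norm (T x + s *\<^sub>R w) > k - s\<^sup>2"
    using x(2)
    by (simp add: cblinfun_apply_add cblinfun_apply_scaleC cblinfun_apply_scaleR
        scaleC_real_mult w_def)
  have Tx: "norm (T x) \<le> k" and Ax: "norm (A x) \<le> norm A"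
    using x(1) by (auto simp: k_def intro: norm_cblinfun_apply_le_unit)
  have "norm (T x + s *\<^sub>R w) \<le> norm (T x) + s * norm (A x)"
    using norm_triangle_ineq[of "T x" "s *\<^sub>R w"] s(1) w by simp
  moreover have "s * norm (A x) \<le> s * norm A"
    using Ax s(1) by simp
  ultimately have near: "norm (T x) > k - (s\<^sup>2 + s * norm A)"
    using step by linarith
  then have half: "norm (T x) > k / 2"
    using s by linarith
  have cw: "c \<le> norm w"
    using c(2)[OF x(1)] near s by (simp add: w k_def)
  have "sqrt (1 - (\<epsilon> s)\<^sup>2) * norm (T x) \<le> norm (T x + t *\<^sub>R w)" if "t \<ge> 0" for t
  proof -
    have "norm (T x + t *\<^sub>R w) \<ge> norm (T x) - (s * norm w + 2 * k / c * s)"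
      using s c(1) cw Tx step \<open>t \<ge> 0\<close>
      by (intro norm_ray_lower_bound) (auto simp: power2_eq_square)
    moreover have "s * norm w + 2 * k / c * s \<le> s * M"
      using s(1) Ax by (simp add: M_def w k_def distrib_left mult.commute)
    moreover have "s * M \<le> 2 * s * M / k * norm (T x)"
      using half s(1) M k by (simp add: field_simps)
    ultimately have "norm (T x + t *\<^sub>R w) \<ge> (1 - 2 * s * M / k) * norm (T x)"
      by (simp add: left_diff_distrib)
    \<comment> \<open>The constant in \<open>\<epsilon>\<close> is chosen for this: with \<open>r = 2 * s * M / k\<close> one has \<open>\<epsilon>\<^sup>2 = 2 * r\<close>, and
      the square of the inequality reads \<open>1 - 2 * r \<le> (1 - r)\<^sup>2\<close>.\<close>
    moreover have "sqrt (1 - (\<epsilon> s)\<^sup>2) \<le> 1 - 2 * s * M / k"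
    proof (rule real_le_lsqrt)
      have sq: "(\<epsilon> s)\<^sup>2 = 4 * s * M / k"
        using s(1) M k by (simp add: \<epsilon>_def)
      have "0 \<le> \<epsilon> s"
        using s(1) M k by (simp add: \<epsilon>_def)
      then have "(\<epsilon> s)\<^sup>2 \<le> 1"
        using s(6) by (simp add: power_le_one)
      then show "0 \<le> 1 - 2 * s * M / k"
        using sq by simp
      have "1 - 2 * r \<le> (1 - r)\<^sup>2" for r :: real
        by (simp add: power2_diff)
      from this[of "2 * s * M / k"] show "1 - (\<epsilon> s)\<^sup>2 \<le> (1 - 2 * s * M / k)\<^sup>2"
        by (simp add: sq)
    qed
    ultimately show ?thesis
      by (meson mult_right_mono norm_ge_zero order_trans)
  qed
  then have "A x \<in> plus_set \<alpha> (\<epsilon> s) (T x)"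
    by (simp add: plus_set_def scaleC_real_mult w_def)
  moreover have "0 < \<epsilon> s"
    using s(1) M k by (simp add: \<epsilon>_def)
  moreover have "norm (T x) > norm T - \<eta>"
    using near s(2) by (simp add: k_def)
  ultimately show ?thesis
    using x(1) s(5,6) by blast
qed

lemma exists_plus_set_sequence:
  fixes T A :: "'a::complex_normed_vector \<Rightarrow>\<^sub>C\<^sub>L 'b::complex_normed_vector"
  assumes "T \<noteq> 0" "T \<bottom>\<^sub>B A" "cmod \<alpha> = 1"
    and "\<nexists>x :: nat \<Rightarrow> 'a. (\<forall>n. norm (x n) = 1) \<and>
      (\<lambda>n. norm (T (x n))) \<longlonglongrightarrow> norm T \<and> (\<lambda>n. norm (A (x n))) \<longlonglongrightarrow> 0"
  shows "\<exists>(x :: nat \<Rightarrow> 'a) (\<epsilon> :: nat \<Rightarrow> real).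
    (\<forall>n. norm (x n) = 1) \<and> (\<forall>n. 0 < \<epsilon> n \<and> \<epsilon> n < 1) \<and> \<epsilon> \<longlonglongrightarrow> 0 \<and>
    (\<lambda>n. norm (T (x n))) \<longlonglongrightarrow> norm T \<and> (\<forall>n. A (x n) \<in> plus_set \<alpha> (\<epsilon> n) (T (x n)))"
proof -
  obtain c where c: "c > 0" "\<And>x. norm x = 1 \<Longrightarrow> norm (T x) > norm T - c \<Longrightarrow> norm (A x) \<ge> c"
    using not_vanishing_gap[OF assms(4)] by blast
  have "\<exists>x \<epsilon>. norm x = 1 \<and> 0 < \<epsilon> \<and> \<epsilon> < 1 \<and> \<epsilon> < inverse (real (Suc n)) \<and>
      norm (T x) > norm T - inverse (real (Suc n)) \<and> A x \<in> plus_set \<alpha> \<epsilon> (T x)" for n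
    by (rule exists_unit_in_plus_set[OF assms(1-3) c]) auto
  then obtain x \<epsilon> where x: "\<And>n. norm (x n) = 1" "\<And>n. 0 < \<epsilon> n" "\<And>n. \<epsilon> n < 1"
      "\<And>n. \<epsilon> n < inverse (real (Suc n))" "\<And>n. norm (T (x n)) > norm T - inverse (real (Suc n))"
      "\<And>n. A (x n) \<in> plus_set \<alpha> (\<epsilon> n) (T (x n))"
    by metis
  have "(\<lambda>n. norm (T (x n))) \<longlonglongrightarrow> norm T"
    using norm_apply_tendsto_norm x by blast
  moreover have "\<epsilon> \<longlonglongrightarrow> 0"
    using x by (intro tendsto_sandwich[OF always_eventually always_eventually tendsto_const
          LIMSEQ_inverse_real_of_nat] allI) (auto intro: less_imp_le)
  ultimately show ?thesis
    using x by blast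
qed

section \<open>From sequences to orthogonality\<close>

lemma norm_add_ge_of_plus_set_sequence:
  fixes T A :: "'a::complex_normed_vector \<Rightarrow>\<^sub>C\<^sub>L 'b::complex_normed_vector"
  assumes "\<forall>n. norm (x n) = 1" "\<epsilon> \<longlonglongrightarrow> 0" "(\<lambda>n::nat. norm (T (x n))) \<longlonglongrightarrow> norm T"
    and mem: "\<forall>n. A (x n) \<in> plus_set \<alpha> (\<epsilon> n) (T (x n))" and "t \<ge> 0"
  shows "norm (T + (of_real t * \<alpha>) *\<^sub>C A) \<ge> norm T"
proof (rule LIMSEQ_le_const2)
  have "(\<lambda>n. sqrt (1 - (\<epsilon> n)\<^sup>2) * norm (T (x n))) \<longlonglongrightarrow> sqrt (1 - 0\<^sup>2) * norm T"
    using assms by (intro tendsto_intros)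
  then show "(\<lambda>n. sqrt (1 - (\<epsilon> n)\<^sup>2) * norm (T (x n))) \<longlonglongrightarrow> norm T"
    by simp
  have "sqrt (1 - (\<epsilon> n)\<^sup>2) * norm (T (x n)) \<le> norm (T + (of_real t * \<alpha>) *\<^sub>C A)" for n
  proof -
    have "sqrt (1 - (\<epsilon> n)\<^sup>2) * norm (T (x n)) \<le> norm ((T + (of_real t * \<alpha>) *\<^sub>C A) (x n))"
      using mem \<open>t \<ge> 0\<close> by (simp add: plus_set_def cblinfun_apply_add cblinfun_apply_scaleC)
    also have "\<dots> \<le> norm (T + (of_real t * \<alpha>) *\<^sub>C A)"
      using assms(1) by (simp add: norm_cblinfun_apply_le_unit)
    finally show ?thesis .
  qed
  then show "\<exists>N. \<forall>n\<ge>N. sqrt (1 - (\<epsilon> n)\<^sup>2) * norm (T (x n)) \<le> norm (T + (of_real t * \<alpha>) *\<^sub>C A)"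
    by blast
qed

lemma BJ_orthogonal_of_vanishing_sequence:
  fixes T A :: "'a::complex_normed_vector \<Rightarrow>\<^sub>C\<^sub>L 'b::complex_normed_vector"
  assumes "\<forall>n. norm (x n) = 1" "(\<lambda>n::nat. norm (T (x n))) \<longlonglongrightarrow> norm T"
    and "(\<lambda>n. norm (A (x n))) \<longlonglongrightarrow> 0"
  shows "T \<bottom>\<^sub>B A"
  unfolding BJ_orthogonal_def
proof (intro allI LIMSEQ_le_const2)
  fix l :: complex
  have "(\<lambda>n. norm (T (x n)) - cmod l * norm (A (x n))) \<longlonglongrightarrow> norm T - cmod l * 0"
    using assms by (intro tendsto_intros)
  then show "(\<lambda>n. norm (T (x n)) - cmod l * norm (A (x n))) \<longlonglongrightarrow> norm T"
    by simp
  have "norm (T (x n)) - cmod l * norm (A (x n)) \<le> norm (T + l *\<^sub>C A)" for n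
  proof -
    have "norm (T (x n)) - cmod l * norm (A (x n)) \<le> norm ((T + l *\<^sub>C A) (x n))"
      using norm_diff_ineq[of "T (x n)" "l *\<^sub>C A (x n)"]
      by (simp add: cblinfun_apply_add cblinfun_apply_scaleC norm_scaleC)
    also have "\<dots> \<le> norm (T + l *\<^sub>C A)"
      using assms(1) by (simp add: norm_cblinfun_apply_le_unit)
    finally show ?thesis .
  qed
  then show "\<exists>N. \<forall>n\<ge>N. norm (T (x n)) - cmod l * norm (A (x n)) \<le> norm (T + l *\<^sub>C A)"
    by blast
qed

lemma unit_half_circle_polar:
  fixes l :: complex
  obtains t :: real and \<alpha> where "\<alpha> \<in> unit_half_circle" "l = of_real t * \<alpha>"
proof (cases "l = 0")
  case True
  have "1 \<in> unit_half_circle"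
    by (simp add: unit_half_circle_def)
  with True that[of 1 0] show ?thesis by simp
next
  case False
  define z where "z = sgn l"
  have z: "cmod z = 1" "z \<noteq> 0"
    using False by (simp_all add: z_def norm_sgn sgn_zero_iff)
  have l: "l = of_real (cmod l) * z"
    using False by (simp add: z_def sgn_div_norm scaleR_conv_of_real)
  show ?thesis
  proof (cases "0 \<le> Arg z \<and> Arg z < pi")
    case True
    then show ?thesis
      using z l that[of z "cmod l"] by (simp add: unit_half_circle_def)
  next
    case False
    then have "0 \<le> Arg (- z) \<and> Arg (- z) < pi"
      using Arg_minus[OF z(2)] mpi_less_Arg[of z] Arg_le_pi[of z] by (auto split: if_splits)
    then show ?thesis
      using z l that[of "- z" "- cmod l"] by (simp add: unit_half_circle_def)
  qed
qed

section \<open>The characterization\<close>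

theorem theorem2p3:
  fixes T A :: "'a::cbanach \<Rightarrow>\<^sub>C\<^sub>L 'b::cbanach"
  assumes "T \<noteq> 0"
  shows "T \<bottom>\<^sub>B A \<longleftrightarrow>
    (\<exists>x :: nat \<Rightarrow> 'a.
        (\<forall>n. norm (x n) = 1) \<and>
        (\<lambda>n. norm (T (x n))) \<longlonglongrightarrow> norm T \<and>
        (\<lambda>n. norm (A (x n))) \<longlonglongrightarrow> 0) \<or>
    (\<forall>\<alpha>\<in>unit_half_circle.
      \<exists>(x :: nat \<Rightarrow> 'a) (y :: nat \<Rightarrow> 'a) (\<epsilon> :: nat \<Rightarrow> real) (\<delta> :: nat \<Rightarrow> real).
        (\<forall>n. norm (x n) = 1) \<and> (\<forall>n. norm (y n) = 1) \<and>
        (\<forall>n. 0 < \<epsilon> n \<and> \<epsilon> n < 1) \<and> (\<forall>n. 0 < \<delta> n \<and> \<delta> n < 1) \<and>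
        \<epsilon> \<longlonglongrightarrow> 0 \<and> \<delta> \<longlonglongrightarrow> 0 \<and>
        (\<lambda>n. norm (T (x n))) \<longlonglongrightarrow> norm T \<and>
        (\<lambda>n. norm (T (y n))) \<longlonglongrightarrow> norm T \<and>
        (\<forall>n. A (x n) \<in> plus_set \<alpha> (\<epsilon> n) (T (x n))) \<and>
        (\<forall>n. A (y n) \<in> minus_set \<alpha> (\<delta> n) (T (y n))))"
    (is "_ \<longleftrightarrow> ?a \<or> (\<forall>\<alpha>\<in>_. ?seqs \<alpha>)" is "_ \<longleftrightarrow> _ \<or> ?b")
proof (intro iffI)
  assume orth: "T \<bottom>\<^sub>B A"
  have ?b if not_a: "\<not> ?a"
  proof
    fix \<alpha> assume "\<alpha> \<in> unit_half_circle"
    then have \<alpha>: "cmod \<alpha> = 1" "cmod (- \<alpha>) = 1"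
      by (auto simp: unit_half_circle_def)
    show "?seqs \<alpha>"
      unfolding minus_set_eq_plus_set
      using exists_plus_set_sequence[OF assms orth \<alpha>(1) not_a]
        exists_plus_set_sequence[OF assms orth \<alpha>(2) not_a]
      by (elim exE conjE) (intro exI conjI; assumption)
  qed
  then show "?a \<or> ?b"
    by blast
next
  assume "?a \<or> ?b"
  then show "T \<bottom>\<^sub>B A"
  proof
    assume ?a
    then show ?thesis
      using BJ_orthogonal_of_vanishing_sequence by blast
  next
    assume b: ?b
    show ?thesis
      unfolding BJ_orthogonal_def
    proof
      fix l :: complex
      obtain t \<alpha> where \<alpha>: "\<alpha> \<in> unit_half_circle" and l: "l = of_real t * \<alpha>"
        by (rule unit_half_circle_polar)
      obtain x y \<epsilon> \<delta> where seqs: "\<forall>n. norm (x n) = 1" "\<forall>n. norm (y n) = 1" "\<epsilon> \<longlonglongrightarrow> 0" "\<delta> \<longlonglongrightarrow> 0"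
          "(\<lambda>n. norm (T (x n))) \<longlonglongrightarrow> norm T" "(\<lambda>n. norm (T (y n))) \<longlonglongrightarrow> norm T"
          "\<forall>n. A (x n) \<in> plus_set \<alpha> (\<epsilon> n) (T (x n))"
          "\<forall>n. A (y n) \<in> plus_set (- \<alpha>) (\<delta> n) (T (y n))"
        using bspec[OF b \<alpha>] unfolding minus_set_eq_plus_set by blast
      show "norm T \<le> norm (T + l *\<^sub>C A)"
      proof (cases "t \<ge> 0")
        case True
        then show ?thesis
          using norm_add_ge_of_plus_set_sequence[OF seqs(1,3,5,7)] l by simp
      next
        case False
        then show ?thesis
          using norm_add_ge_of_plus_set_sequence[OF seqs(2,4,6,8), of "- t"] l by simp
      qed
    qed
  qed
qed

end
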